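(* Let $\mathscr{F}\subseteq\mathscr{P}(\omega)$ be a nonempty $\omega$-closed family. A non-zero element $(i,j,F)$ of the semigroup $\boldsymbol{B}_{\omega}^{\mathscr{F}}$ is an idempotent if and only if $i=j$.
   Context: $\omega$ is the set of non-negative integers, $\mathscr{P}(\omega)$ its power set. For an integer $n$ and $F\subseteq\omega$ put $n+F=\{n+k\colon k\in F\}\subseteq\mathbb{Z}$ (empty if $F=\varnothing$). A family $\mathscr{F}\subseteq\mathscr{P}(\omega)$ is $\omega$-closed if $F_1\cap(-n+F_2)\in\mathscr{F}$ for all $n\in\omega$ and $F_1,F_2\in\mathscr{F}$. For an $\omega$-closed family $\mathscr{F}$, the set $\boldsymbol{B}_{\omega}\times\mathscr{F}=\omega\times\omega\times\mathscr{F}$ carries the semigroup operation $$(i_1,j_1,F_1)\cdot(i_2,j_2,F_2)=\begin{cases}(i_1-j_1+i_2,\,j_2,\,(j_1-i_2+F_1)\cap F_2), & j_1\leqslant i_2;\\ (i_1,\,j_1-i_2+j_2,\,F_1\cap(i_2-j_1+F_2)), & j_1\geqslant i_2.\end{cases}$$ If $\varnothing\notin\mathscr{F}$, then $\boldsymbol{B}_{\omega}^{\mathscr{F}}=(\boldsymbol{B}_{\omega}\times\mathscr{F},\cdot)$. If $\varnothing\in\mathscr{F}$, then $\boldsymbol{I}=\{(i,j,\varnothing)\colon i,j\in\omega\}$ is an ideal and $\boldsymbol{B}_{\omega}^{\mathscr{F}}$ is the Rees quotient $(\boldsymbol{B}_{\omega}\times\mathscr{F},\cdot)/\boldsymbol{I}$,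 in which all $(i,j,\varnothing)$ are identified to a single zero element $\boldsymbol{0}$; the non-zero elements are the $(i,j,F)$ with $F\neq\varnothing$. *)

theory Defs
  imports "HOL-Algebra.Congruence"
begin

section \<open>Semigroups and Rees quotients\<close>

text \<open>The \<open>monoid\<close> record of HOL-Algebra carries a unit, which a semigroup need not have,
  hence a record of our own.\<close>

record 'a semigrp = "'a partial_object" +
  sprod :: "'a \<Rightarrow> 'a \<Rightarrow> 'a" (infixl \<open>\<odot>\<index>\<close> 70)

definition is_semigrp :: "('a, 'm) semigrp_scheme \<Rightarrow> bool" where
  "is_semigrp S \<longleftrightarrow>
     (\<forall>x \<in> carrier S. \<forall>y \<in> carrier S. x \<odot>\<^bsub>S\<^esub> y \<in> carrier S) \<and>
     (\<forall>x \<in> carrier S. \<forall>y \<in> carrier S. \<forall>z \<in> carrier S.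
        (x \<odot>\<^bsub>S\<^esub> y) \<odot>\<^bsub>S\<^esub> z = x \<odot>\<^bsub>S\<^esub> (y \<odot>\<^bsub>S\<^esub> z))"

definition is_idempotent :: "('a, 'm) semigrp_scheme \<Rightarrow> 'a \<Rightarrow> bool" where
  "is_idempotent S x \<longleftrightarrow> x \<in> carrier S \<and> x \<odot>\<^bsub>S\<^esub> x = x"

definition rees_congruence :: "('a, 'm) semigrp_scheme \<Rightarrow> 'a set \<Rightarrow> ('a \<times> 'a) set" where
  "rees_congruence S I = Id_on (carrier S) \<union> I \<times> I"

text \<open>The product of two classes is the class of the product of representatives; the union
  over all representatives makes this independent of a choice. For \<open>I = {}\<close> the
  congruence is equality and the quotient is a copy of \<open>S\<close> with \<open>{x}\<close> in the role of \<open>x\<close>.\<close>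

definition rees_quotient :: "('a, 'm) semigrp_scheme \<Rightarrow> 'a set \<Rightarrow> 'a set semigrp" where
  "rees_quotient S I =
     \<lparr> carrier = carrier S // rees_congruence S I,
       sprod = (\<lambda>X Y. \<Union>x \<in> X. \<Union>y \<in> Y. rees_congruence S I `` {x \<odot>\<^bsub>S\<^esub> y}) \<rparr>"


section \<open>The semigroup \<open>B\<^sub>\<omega>\<^sup>F\<close>\<close>

definition shift :: "int \<Rightarrow> nat set \<Rightarrow> int set" where
  "shift n F = (\<lambda>k. n + int k) ` F"

text \<open>Intersecting a set of naturals with a shifted set in \<open>\<int>\<close> is done through the
  preimage \<open>int -` _\<close>.\<close>

definition omega_closed :: "nat set set \<Rightarrow> bool" where
  "omega_closed \<F> \<longleftrightarrow>
     (\<forall>n::nat. \<forall>F1 \<in> \<F>. \<forall>F2 \<in> \<F>. F1 \<inter> int -` shift (- int n) F2 \<in> \<F>)"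

text \<open>Both subtractions on \<open>nat\<close> below are exact, thanks to the case distinction.\<close>

fun triple_mult ::
  "nat \<times> nat \<times> nat set \<Rightarrow> nat \<times> nat \<times> nat set \<Rightarrow> nat \<times> nat \<times> nat set" where
  "triple_mult (i1, j1, F1) (i2, j2, F2) =
     (if j1 \<le> i2
      then (i1 + i2 - j1, j2, int -` shift (int j1 - int i2) F1 \<inter> F2)
      else (i1, j1 - i2 + j2, F1 \<inter> int -` shift (int i2 - int j1) F2))"

definition B_omega_times :: "nat set set \<Rightarrow> (nat \<times> nat \<times> nat set) semigrp" where
  "B_omega_times \<F> = \<lparr> carrier = UNIV \<times> UNIV \<times> \<F>, sprod = triple_mult \<rparr>"

text \<open>The ideal is empty when \<open>{} \<notin> \<F>\<close>, so the quotient below covers both cases of the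
  definition: for \<open>{} \<notin> \<F>\<close> nothing is identified.\<close>

definition empty_ideal :: "nat set set \<Rightarrow> (nat \<times> nat \<times> nat set) set" where
  "empty_ideal \<F> = {(i, j, F). F \<in> \<F> \<and> F = {}}"

definition B_omega :: "nat set set \<Rightarrow> (nat \<times> nat \<times> nat set) set semigrp" where
  "B_omega \<F> = rees_quotient (B_omega_times \<F>) (empty_ideal \<F>)"

definition B_elem :: "nat set set \<Rightarrow> nat \<Rightarrow> nat \<Rightarrow> nat set \<Rightarrow> (nat \<times> nat \<times> nat set) set" where
  "B_elem \<F> i j F = rees_congruence (B_omega_times \<F>) (empty_ideal \<F>) `` {(i, j, F)}"


section \<open>Well-definedness\<close>

lemma int_mem_shift: "int m \<in> shift n F \<longleftrightarrow> 0 \<le> int m - n \<and> nat (int m - n) \<in> F"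
  by (force simp: shift_def image_iff)

lemma triple_mult_at_equal:
  "triple_mult (i1, j, F1) (j, j2, F2) = (i1, j - j + j2, F1 \<inter> int -` shift (int j - int j) F2)"
  by (auto simp: int_mem_shift)

lemma triple_mult_closed:
  assumes "omega_closed \<F>" "F1 \<in> \<F>" "F2 \<in> \<F>"
  shows "triple_mult (i1, j1, F1) (i2, j2, F2) \<in> carrier (B_omega_times \<F>)"
proof (cases "j1 \<le> i2")
  case True
  have "F2 \<inter> int -` shift (- int (i2 - j1)) F1 \<in> \<F>"
    using assms by (auto simp: omega_closed_def)
  then show ?thesis using True by (simp add: B_omega_times_def of_nat_diff Int_commute)
next
  case False
  have "F1 \<inter> int -` shift (- int (j1 - i2)) F2 \<in> \<F>"
    using assms by (auto simp: omega_closed_def)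
  then show ?thesis using False by (simp add: B_omega_times_def of_nat_diff)
qed

lemma triple_mult_max:
  "triple_mult (i1, j1, F1) (i2, j2, F2) =
     (i1 + (max j1 i2 - j1), j2 + (max j1 i2 - i2),
      {k. k + (max j1 i2 - j1) \<in> F1 \<and> k + (max j1 i2 - i2) \<in> F2})"
proof (cases "j1 \<le> i2")
  case True
  have "nat (int k - (int j1 - int i2)) = k + (i2 - j1)" for k
    using True by linarith
  then show ?thesis using True by (auto simp: int_mem_shift max_absorb2)
next
  case False
  have "nat (int k - (int i2 - int j1)) = k + (j1 - i2)" for k
    using False by linarith
  then show ?thesis using False by (auto simp: int_mem_shift max_absorb1)
qed

lemma triple_mult_assoc:
  "triple_mult (triple_mult x y) z = triple_mult x (triple_mult y z)"
proof -
  obtain i1 j1 F1 i2 j2 F2 i3 j3 F3 where xyz: "x = (i1, j1, F1)" "y = (i2, j2, F2)" "z = (i3, j3, F3)"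
    by (metis prod_cases3)
  define m where "m = max j1 i2"
  define n where "n = max j2 i3"
  define p where "p = max (j2 + (m - i2)) i3"
  define q where "q = max j1 (i2 + (n - j2))"
  have e: "(m - j1) + (p - (j2 + (m - i2))) = q - j1"
    "(m - i2) + (p - (j2 + (m - i2))) = (n - j2) + (q - (i2 + (n - j2)))"
    "p - i3 = (n - i3) + (q - (i2 + (n - j2)))"
    unfolding m_def n_def p_def q_def by linarith+
  have ek: "k + (p - (j2 + (m - i2))) + (m - j1) = k + (q - j1)"
    "k + (p - (j2 + (m - i2))) + (m - i2) = k + (q - (i2 + (n - j2))) + (n - j2)"
    "k + (p - i3) = k + (q - (i2 + (n - j2))) + (n - i3)" for k
    using e by linarith+
  then show ?thesis
    unfolding xyz triple_mult_max m_def[symmetric] n_def[symmetric] p_def[symmetric] q_def[symmetric]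
    by (simp only: prod.inject mem_Collect_eq conj_assoc ek, intro conjI refl; insert e; linarith)
qed

lemma semigrp_B_omega_times:
  assumes "omega_closed \<F>"
  shows "is_semigrp (B_omega_times \<F>)"
proof -
  have "triple_mult x y \<in> UNIV \<times> UNIV \<times> \<F>"
    if "x \<in> UNIV \<times> UNIV \<times> \<F>" "y \<in> UNIV \<times> UNIV \<times> \<F>" for x y
    using that triple_mult_closed[OF assms]
    by (cases x; cases y) (simp add: B_omega_times_def del: triple_mult.simps)
  then show ?thesis
    by (auto simp: is_semigrp_def B_omega_times_def triple_mult_assoc)
qed

lemma empty_ideal:
  assumes "x \<in> empty_ideal \<F>" "y \<in> carrier (B_omega_times \<F>)"
  shows "triple_mult x y \<in> empty_ideal \<F>" "triple_mult y x \<in> empty_ideal \<F>"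
  using assms
  by (cases x; cases y;
      simp add: empty_ideal_def B_omega_times_def triple_mult_max del: triple_mult.simps)+

lemma equiv_rees_congruence:
  "equiv (carrier (B_omega_times \<F>)) (rees_congruence (B_omega_times \<F>) (empty_ideal \<F>))"
  by (auto simp: equiv_def refl_on_def sym_def trans_def rees_congruence_def
      B_omega_times_def empty_ideal_def)

lemma B_elem_nonempty: "F \<in> \<F> \<Longrightarrow> F \<noteq> {} \<Longrightarrow> B_elem \<F> i j F = {(i, j, F)}"
  by (auto simp: B_elem_def rees_congruence_def B_omega_times_def empty_ideal_def)

lemma B_elem_empty: "{} \<in> \<F> \<Longrightarrow> B_elem \<F> i j {} = empty_ideal \<F>"
  by (auto simp: B_elem_def rees_congruence_def B_omega_times_def empty_ideal_def)

lemma carrier_B_omega: "carrier (B_omega \<F>) = {B_elem \<F> i j F | i j F. F \<in> \<F>}"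
  by (auto simp: B_omega_def rees_quotient_def quotient_def B_elem_def B_omega_times_def)

lemma B_omega_prod:
  assumes "omega_closed \<F>" "F1 \<in> \<F>" "F2 \<in> \<F>"
    and "triple_mult (i1, j1, F1) (i2, j2, F2) = (i, j, F)"
  shows "B_elem \<F> i1 j1 F1 \<odot>\<^bsub>B_omega \<F>\<^esub> B_elem \<F> i2 j2 F2 = B_elem \<F> i j F"
proof -
  let ?S = "B_omega_times \<F>" and ?r = "rees_congruence (B_omega_times \<F>) (empty_ideal \<F>)"
  have cl: "x \<in> carrier ?S \<and> y \<in> carrier ?S" if "(x, y) \<in> ?r" for x y
    using that by (auto simp: rees_congruence_def B_omega_times_def empty_ideal_def)
  have cg: "(triple_mult x y, triple_mult x' y') \<in> ?r" if "(x, x') \<in> ?r" "(y, y') \<in> ?r" for x x' y y'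
  proof (cases "x = x' \<and> y = y'")
    case True
    have "triple_mult x y \<in> carrier ?S"
      using cl[OF that(1)] cl[OF that(2)] semigrp_B_omega_times[OF assms(1)]
      unfolding is_semigrp_def by (auto simp: B_omega_times_def)
    then show ?thesis using True by (auto simp: rees_congruence_def)
  next
    case False
    then have "x \<in> empty_ideal \<F> \<and> x' \<in> empty_ideal \<F> \<or> y \<in> empty_ideal \<F> \<and> y' \<in> empty_ideal \<F>"
      using that by (auto simp: rees_congruence_def)
    then have "triple_mult x y \<in> empty_ideal \<F>" "triple_mult x' y' \<in> empty_ideal \<F>"
      using empty_ideal cl[OF that(1)] cl[OF that(2)] by blast+
    then show ?thesis by (simp add: rees_congruence_def)
  qed
  have self: "((i1, j1, F1), (i1, j1, F1)) \<in> ?r" "((i2, j2, F2), (i2, j2, F2)) \<in> ?r"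
    using assms by (auto simp: rees_congruence_def B_omega_times_def)
  have eq: "?r `` {triple_mult x y} = ?r `` {(i, j, F)}"
    if "x \<in> B_elem \<F> i1 j1 F1" "y \<in> B_elem \<F> i2 j2 F2" for x y
  proof -
    have "((i, j, F), triple_mult x y) \<in> ?r"
      using cg[of "(i1, j1, F1)" x "(i2, j2, F2)" y] that assms(4) by (simp add: B_elem_def)
    then show ?thesis using equiv_class_eq[OF equiv_rees_congruence] by blast
  qed
  have "(i1, j1, F1) \<in> B_elem \<F> i1 j1 F1" "(i2, j2, F2) \<in> B_elem \<F> i2 j2 F2"
    using self by (auto simp: B_elem_def)
  then have "(\<Union>x \<in> B_elem \<F> i1 j1 F1. \<Union>y \<in> B_elem \<F> i2 j2 F2. ?r `` {triple_mult x y})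
      = ?r `` {(i, j, F)}"
    using eq by blast
  then show ?thesis
    by (simp add: B_omega_def rees_quotient_def B_elem_def B_omega_times_def)
qed

lemma B_omega_zero:
  assumes "omega_closed \<F>" "{} \<in> \<F>" "x \<in> carrier (B_omega \<F>)"
  shows "empty_ideal \<F> \<odot>\<^bsub>B_omega \<F>\<^esub> x = empty_ideal \<F>"
    and "x \<odot>\<^bsub>B_omega \<F>\<^esub> empty_ideal \<F> = empty_ideal \<F>"
proof -
  obtain i j F where x: "x = B_elem \<F> i j F" "F \<in> \<F>"
    using assms(3) by (auto simp: carrier_B_omega)
  show "empty_ideal \<F> \<odot>\<^bsub>B_omega \<F>\<^esub> x = empty_ideal \<F>"
    using B_omega_prod[OF assms(1,2) x(2) triple_mult_max, of 0 0 i j] assms(2)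
    by (simp add: x(1) B_elem_empty)
  show "x \<odot>\<^bsub>B_omega \<F>\<^esub> empty_ideal \<F> = empty_ideal \<F>"
    using B_omega_prod[OF assms(1) x(2) assms(2) triple_mult_max, of i j 0 0] assms(2)
    by (simp add: x(1) B_elem_empty)
qed

lemma B_elem_eq_zero_iff: "F \<in> \<F> \<Longrightarrow> B_elem \<F> i j F = empty_ideal \<F> \<longleftrightarrow> F = {}"
proof (cases "F = {}")
  case False
  then have "(i, j, F) \<notin> empty_ideal \<F>" by (simp add: empty_ideal_def)
  moreover assume "F \<in> \<F>"
  ultimately have "B_elem \<F> i j F \<noteq> empty_ideal \<F>"
    using False B_elem_nonempty[of F \<F> i j] by (metis singletonI)
  then show ?thesis using False by simp
qed (simp add: B_elem_empty)

lemma semigrp_B_omega: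
  assumes "omega_closed \<F>"
  shows "is_semigrp (B_omega \<F>)"
proof -
  have prod: "\<exists>i j F. F \<in> \<F> \<and> triple_mult (i1, j1, F1) (i2, j2, F2) = (i, j, F) \<and>
      B_elem \<F> i1 j1 F1 \<odot>\<^bsub>B_omega \<F>\<^esub> B_elem \<F> i2 j2 F2 = B_elem \<F> i j F"
    if "F1 \<in> \<F>" "F2 \<in> \<F>" for i1 j1 F1 i2 j2 F2
  proof -
    obtain i j F where t: "triple_mult (i1, j1, F1) (i2, j2, F2) = (i, j, F)"
      by (metis prod_cases3)
    then have "F \<in> \<F>"
      using triple_mult_closed[OF assms that, of i1 j1 i2 j2] unfolding t
      by (simp add: B_omega_times_def)
    with t B_omega_prod[OF assms that t] show ?thesis by blast
  qed
  show ?thesis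
    unfolding is_semigrp_def
  proof (intro conjI ballI)
    fix x y assume "x \<in> carrier (B_omega \<F>)" "y \<in> carrier (B_omega \<F>)"
    then obtain i1 j1 F1 i2 j2 F2 where xy: "x = B_elem \<F> i1 j1 F1" "F1 \<in> \<F>"
      "y = B_elem \<F> i2 j2 F2" "F2 \<in> \<F>"
      unfolding carrier_B_omega by blast
    then show "x \<odot>\<^bsub>B_omega \<F>\<^esub> y \<in> carrier (B_omega \<F>)"
      using prod[of F1 F2 i1 j1 i2 j2] unfolding carrier_B_omega by auto
  next
    fix x y z
    assume "x \<in> carrier (B_omega \<F>)" "y \<in> carrier (B_omega \<F>)" "z \<in> carrier (B_omega \<F>)"
    then obtain i1 j1 F1 i2 j2 F2 i3 j3 F3 where xyz: "x = B_elem \<F> i1 j1 F1" "F1 \<in> \<F>"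
      "y = B_elem \<F> i2 j2 F2" "F2 \<in> \<F>" "z = B_elem \<F> i3 j3 F3" "F3 \<in> \<F>"
      unfolding carrier_B_omega by blast
    obtain a b A where A: "A \<in> \<F>" "triple_mult (i1, j1, F1) (i2, j2, F2) = (a, b, A)"
      "x \<odot>\<^bsub>B_omega \<F>\<^esub> y = B_elem \<F> a b A"
      using prod[of F1 F2 i1 j1 i2 j2] xyz by auto
    obtain c d C where C: "C \<in> \<F>" "triple_mult (i2, j2, F2) (i3, j3, F3) = (c, d, C)"
      "y \<odot>\<^bsub>B_omega \<F>\<^esub> z = B_elem \<F> c d C"
      using prod[of F2 F3 i2 j2 i3 j3] xyz by auto
    have "triple_mult (a, b, A) (i3, j3, F3) = triple_mult (i1, j1, F1) (c, d, C)"
      unfolding A(2)[symmetric] C(2)[symmetric] by (rule triple_mult_assoc)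
    then show "(x \<odot>\<^bsub>B_omega \<F>\<^esub> y) \<odot>\<^bsub>B_omega \<F>\<^esub> z = x \<odot>\<^bsub>B_omega \<F>\<^esub> (y \<odot>\<^bsub>B_omega \<F>\<^esub> z)"
      unfolding A(3) C(3)
      using prod[OF A(1) xyz(6), of a b i3 j3] prod[OF xyz(2) C(1), of i1 j1 c d]
      unfolding xyz(1,5) by (auto simp del: triple_mult.simps)
  qed
qed

end

theory Submission
  imports Defs
begin

text \<open>The Rees congruence collapses only triples with empty third component, so the class of
  \<open>(i, j, F)\<close> with \<open>F \<noteq> {}\<close> is idempotent exactly if the triple itself is (lemma
  \<open>B_elem_eq_iff\<close>). Squaring the triple raises both coordinates by what is needed to match the
  inner \<open>j\<close> with the inner \<open>i\<close>: with \<open>m = max j i\<close> they become \<open>i + (m - j)\<close> and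
  \<open>j + (m - i)\<close>, and the set becomes \<open>{k. k + (m - j) \<in> F \<and> k + (m - i) \<in> F}\<close>. The
  coordinates are unchanged only if \<open>m = j\<close> and \<open>m = i\<close>, that is \<open>i = j\<close>; and then
  nothing is shifted, so the set is \<open>F \<inter> F = F\<close> (lemma \<open>triple_mult_self_iff\<close>).\<close>

lemma triple_mult_self_iff: "triple_mult (i, j, F) (i, j, F) = (i, j, F) \<longleftrightarrow> i = j"
  unfolding triple_mult_max by auto

text \<open>Only one of the two sets has to be nonempty: its class is then a singleton, and the class
  of a triple with empty set is the zero, which contains no triple with nonempty set.\<close>

lemma B_elem_eq_iff:
  assumes "F \<in> \<F>" "F \<noteq> {}" "G \<in> \<F>"
  shows "B_elem \<F> a b G = B_elem \<F> i j F \<longleftrightarrow> (a, b, G) = (i, j, F)"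
proof (cases "G = {}")
  case True
  then show ?thesis
    using assms B_elem_eq_zero_iff[of F \<F> i j] B_elem_empty[of \<F> a b] by auto
next
  case False
  then show ?thesis using assms by (simp add: B_elem_nonempty)
qed

theorem mainTheorem4:
  fixes \<F> :: "nat set set" and i j :: nat and F :: "nat set"
  assumes "\<F> \<noteq> {}" and "omega_closed \<F>"
    and "F \<in> \<F>" and "F \<noteq> {}"
  shows "is_idempotent (B_omega \<F>) (B_elem \<F> i j F) \<longleftrightarrow> i = j"
proof -
  obtain a b G where sq: "triple_mult (i, j, F) (i, j, F) = (a, b, G)"
    by (metis prod_cases3)
  have G: "G \<in> \<F>"
    using triple_mult_closed[OF assms(2,3,3), of i j i j] unfolding sq
    by (simp add: B_omega_times_def)
  have "B_elem \<F> i j F \<in> carrier (B_omega \<F>)"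
    using assms(3) by (auto simp: carrier_B_omega)
  then have "is_idempotent (B_omega \<F>) (B_elem \<F> i j F) \<longleftrightarrow> B_elem \<F> a b G = B_elem \<F> i j F"
    by (simp add: is_idempotent_def B_omega_prod[OF assms(2,3,3) sq])
  also have "\<dots> \<longleftrightarrow> triple_mult (i, j, F) (i, j, F) = (i, j, F)"
    unfolding sq by (rule B_elem_eq_iff[OF assms(3,4) G])
  also have "\<dots> \<longleftrightarrow> i = j"
    by (rule triple_mult_self_iff)
  finally show ?thesis .
qed

end
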